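(* Let $\theta\in[1/2,1]$ and let $c,\Delta_0,\rho,L,T>0$. Set $C=16c^{-4}\Delta_0^{1-4\theta}\rho L^2$, $$\psi(x)=\Delta_0\left(\frac{Cx}{T}\right)^{\frac{1-(4\theta)^{-x}}{4\theta-1}}\quad(x\in\mathbb{R}_+),\qquad N^*=\operatorname*{argmin}_{x\in\mathbb{R}_+}\psi(x).$$ Then, for $\tau>0$, as $\tau\to1$, $$\frac{\psi(\tau N^* )}{\psi(N^* )}=1+\frac{N^*\log(4\theta)\left((4\theta)^{-N^*}+1\right)+(4\theta)^{-N^*}-1}{2(4\theta-1)}(\log\tau)^2+o\left((\log\tau)^2\right).$$ Furthermore, for every $\tau>1$, $$\frac{\psi(\tau N^* )}{\psi(N^* )}<\tau^{1/(4\theta-1)}.$$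
   Context: The minimizer $N^*$ exists, is unique and is positive; $\psi(0)=\Delta_0$ by the convention $0^0=1$. The constants come from the complexity analysis of a restarted projected stochastic subgradient method ($\theta,c$: Kurdyka-Łojasiewicz exponent and constant, $\Delta_0$: initial gap, $\rho$: weak convexity constant, $L$: second-moment bound on stochastic subgradients, $T$: total iteration budget), where $\psi(N)$ is the upper bound on the optimality gap after $N$ restarts; for this statement they are just fixed positive numbers. *)

theory Defs
  imports "HOL-Analysis.Analysis" "HOL-Library.Landau_Symbols"
begin

text \<open>Real powers with \<open>0\<^sup>0 = 1\<close>; the library's \<^const>\<open>powr\<close> has \<open>0 powr 0 = 0\<close>.\<close>

definition rpow :: "real \<Rightarrow> real \<Rightarrow> real" where
  "rpow a b = (if a = 0 \<and> b = 0 then 1 else a powr b)"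

definition restart_C :: "real \<Rightarrow> real \<Rightarrow> real \<Rightarrow> real \<Rightarrow> real \<Rightarrow> real" where
  "restart_C \<theta> c \<Delta>\<^sub>0 \<rho> L = 16 * c powi (-4) * \<Delta>\<^sub>0 powr (1 - 4 * \<theta>) * \<rho> * L\<^sup>2"

text \<open>Only the values at \<open>x \<ge> 0\<close> are meaningful.\<close>

definition restart_psi ::
    "real \<Rightarrow> real \<Rightarrow> real \<Rightarrow> real \<Rightarrow> real \<Rightarrow> real \<Rightarrow> real \<Rightarrow> real" where
  "restart_psi \<theta> c \<Delta>\<^sub>0 \<rho> L T x =
     \<Delta>\<^sub>0 * rpow (restart_C \<theta> c \<Delta>\<^sub>0 \<rho> L * x / T)
               ((1 - (4 * \<theta>) powr (- x)) / (4 * \<theta> - 1))"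

definition restart_opt :: "real \<Rightarrow> real \<Rightarrow> real \<Rightarrow> real \<Rightarrow> real \<Rightarrow> real \<Rightarrow> real" where
  "restart_opt \<theta> c \<Delta>\<^sub>0 \<rho> L T = arg_min_on (restart_psi \<theta> c \<Delta>\<^sub>0 \<rho> L T) {0..}"

end

theory Submission
  imports Defs "HOL-Real_Asymp.Real_Asymp"
begin

text \<open>
  In the variable \<open>s = ln \<tau>\<close>, with \<open>b = N ln (4\<theta>)\<close> and \<open>l = ln (C N / T)\<close>, the ratio
  \<open>\<psi> (\<tau> N) / \<psi> N\<close> is \<open>exp (G s)\<close> for
  \<open>G s = ((1 - exp (- b exp s)) (l + s) - (1 - exp (- b)) l) / (4\<theta> - 1)\<close>. Minimality of \<open>N\<close> makes
  \<open>s = 0\<close> a minimum of \<open>G\<close>, and \<open>G' 0 = 0\<close> gives \<open>b exp (- b) l = exp (- b) - 1\<close>, which eliminates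
  \<open>l\<close> from \<open>G'' 0\<close>; a second-order Taylor expansion yields the first claim. As \<open>\<psi> N < \<psi> 0\<close>, also
  \<open>l < 0\<close>, so for \<open>s > 0\<close> both \<open>(1 - exp (- b exp s)) s < s\<close> and
  \<open>(exp (- b) - exp (- b exp s)) l < 0\<close>, which gives the second claim.
\<close>

text \<open>One use of l'Hopital on the remainder over \<open>(x - x0)\<^sup>2\<close> leaves
  \<open>(f' x - f' x0 - A * (x - x0)) / (2 * (x - x0))\<close>, which tends to 0 by the very
  definition of \<open>A\<close> as derivative of \<open>f'\<close> at \<open>x0\<close>. So
  \<open>f'\<close> has to be differentiable at that single point only.\<close>

lemma taylor_peano_second_order:
  fixes f f' :: "real \<Rightarrow> real"
  assumes f: "\<forall>\<^sub>F x in at x0. (f has_real_derivative f' x) (at x)"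
    and f0: "(f has_real_derivative f' x0) (at x0)"
    and f': "(f' has_real_derivative A) (at x0)"
  shows "(\<lambda>x. f x - (f x0 + f' x0 * (x - x0) + A / 2 * (x - x0)\<^sup>2)) \<in> o[at x0](\<lambda>x. (x - x0)\<^sup>2)"
proof (rule smalloI_tendsto)
  have "((\<lambda>x. (f' x - f' x0) / (x - x0)) \<longlongrightarrow> A) (at x0)"
    using f' by (simp add: has_field_derivative_iff)
  from tendsto_divide[OF tendsto_diff[OF this tendsto_const[of A]] tendsto_const[of 2]]
  have "((\<lambda>x. ((f' x - f' x0) / (x - x0) - A) / 2) \<longlongrightarrow> 0) (at x0)"
    by simp
  then have lim: "((\<lambda>x. (f' x - (f' x0 + A * (x - x0))) / (2 * (x - x0))) \<longlongrightarrow> 0) (at x0)"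
    by (rule Lim_transform_eventually) (auto simp: eventually_at_filter divide_simps algebra_simps)
  have cont: "isCont f x0"
    using f0 by (rule DERIV_isCont)
  have lim0: "((\<lambda>x. f x - (f x0 + f' x0 * (x - x0) + A / 2 * (x - x0)\<^sup>2)) \<longlongrightarrow> 0) (at x0)"
    using cont unfolding isCont_def by (auto intro!: tendsto_eq_intros)
  show "((\<lambda>x. (f x - (f x0 + f' x0 * (x - x0) + A / 2 * (x - x0)\<^sup>2)) / (x - x0)\<^sup>2) \<longlongrightarrow> 0) (at x0)"
  proof (rule lhopital[OF lim0 _ _ _ _ _ lim])
    show "((\<lambda>x. (x - x0)\<^sup>2) \<longlongrightarrow> 0) (at x0)"
      by (auto intro!: tendsto_eq_intros)
    show "\<forall>\<^sub>F x in at x0. ((\<lambda>x. f x - (f x0 + f' x0 * (x - x0) + A / 2 * (x - x0)\<^sup>2))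
        has_real_derivative f' x - (f' x0 + A * (x - x0))) (at x)"
      using f by eventually_elim (auto intro!: derivative_eq_intros simp: field_simps)
    show "\<forall>\<^sub>F x in at x0. ((\<lambda>x. (x - x0)\<^sup>2) has_real_derivative 2 * (x - x0)) (at x)"
      by (auto intro!: derivative_eq_intros always_eventually)
  qed (auto simp: eventually_at_filter)
qed (auto simp: eventually_at_filter)

text \<open>\<open>\<phi>\<close> is, up to a positive factor, the exponent of
  \<open>restart_psi\<close>. It tends to 0 at the left end, is nonnegative from
  \<open>1 / k\<close> on and is negative somewhere between, so a minimum over a compact interval is
  a minimum over all positive reals.\<close>

lemma exp_log_product_has_min:
  fixes a k :: real
  assumes "a > 0" "k > 0"
  defines "\<phi> \<equiv> \<lambda>x. (1 - exp (- (a * x))) * ln (k * x)"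
  obtains m where "m > 0" "\<phi> m < 0" "\<And>x. x > 0 \<Longrightarrow> \<phi> m \<le> \<phi> x"
proof -
  \<comment> \<open>A point below \<open>1 / k\<close>, where the logarithm is negative and hence
    \<open>\<phi>\<close> too.\<close>
  define y where "y = 1 / (2 * k)"
  have y: "y > 0" "k * y = 1 / 2" using assms by (auto simp: y_def)
  have \<phi>y: "\<phi> y < 0"
    using y assms(1) by (auto simp: \<phi>_def mult_less_0_iff)
  have "(\<phi> \<longlongrightarrow> 0) (at_right 0)"
    unfolding \<phi>_def using assms(1,2) by real_asymp
  then have "\<forall>\<^sub>F x in at_right 0. \<phi> y < \<phi> x"
    using \<phi>y by (rule order_tendstoD)
  then obtain \<epsilon> where \<epsilon>: "\<epsilon> > 0" "\<And>x. 0 < x \<Longrightarrow> x < \<epsilon> \<Longrightarrow> \<phi> y < \<phi> x"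
    by (auto simp: eventually_at_right_field)
  have nonneg: "\<phi> x \<ge> 0" if "x \<ge> 1 / k" for x
  proof -
    have "k * x \<ge> 1" using that assms(2) by (simp add: field_simps)
    moreover have "x > 0" using that assms(2) by (meson less_le_trans zero_less_divide_1_iff)
    ultimately show ?thesis using assms(1) by (auto simp: \<phi>_def)
  qed
  \<comment> \<open>\<open>y < \<epsilon>\<close> would give \<open>\<phi> y < \<phi> y\<close>, and
    \<open>y\<close> beyond \<open>1 / k\<close> would give \<open>\<phi> y \<ge> 0\<close>. In
    particular the interval is nonempty.\<close>
  have yI: "y \<in> {\<epsilon>..1 / k}"
    using \<epsilon>(2)[of y] y(1) nonneg[of y] \<phi>y by force
  have "continuous_on {\<epsilon>..1 / k} \<phi>"
    unfolding \<phi>_def using \<epsilon>(1) assms(2) by (auto intro!: continuous_intros)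
  then obtain m where m: "m \<in> {\<epsilon>..1 / k}" "\<And>x. x \<in> {\<epsilon>..1 / k} \<Longrightarrow> \<phi> m \<le> \<phi> x"
    using continuous_attains_inf[of "{\<epsilon>..1 / k}" \<phi>] yI by auto
  have my: "\<phi> m \<le> \<phi> y" using m(2) yI by blast
  show thesis
  proof (rule that[of m])
    show "\<phi> m \<le> \<phi> x" if "x > 0" for x
    proof (cases "x \<in> {\<epsilon>..1 / k}")
      case False
      then consider "x < \<epsilon>" | "x \<ge> 1 / k" by fastforce
      then show ?thesis
        using \<epsilon>(2)[of x] nonneg[of x] that my \<phi>y by cases auto
    qed (use m in auto)
  qed (use m \<epsilon> my \<phi>y in auto)
qed

lemma restart_C_pos:
  assumes "c > 0" "\<Delta>\<^sub>0 > 0" "\<rho> > 0" "L > 0"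
  shows "restart_C \<theta> c \<Delta>\<^sub>0 \<rho> L > 0"
  using assms by (simp add: restart_C_def)

lemma restart_psi_0: "\<theta> \<noteq> 0 \<Longrightarrow> restart_psi \<theta> c \<Delta>\<^sub>0 \<rho> L T 0 = \<Delta>\<^sub>0"
  by (simp add: restart_psi_def rpow_def)

lemma restart_psi_pos_eq_exp:
  assumes "\<theta> > 0" "x > 0" "restart_C \<theta> c \<Delta>\<^sub>0 \<rho> L > 0" "T > 0"
  shows "restart_psi \<theta> c \<Delta>\<^sub>0 \<rho> L T x =
    \<Delta>\<^sub>0 * exp ((1 - exp (- (ln (4 * \<theta>) * x))) * ln (restart_C \<theta> c \<Delta>\<^sub>0 \<rho> L / T * x) / (4 * \<theta> - 1))"
  using assms by (simp add: restart_psi_def rpow_def powr_def mult_ac)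

text \<open>\<open>arg_min_on\<close> is a choice operator, so its value is known to minimize only
  once some minimizer is exhibited. On positive reals monotonicity of \<open>exp\<close> carries the
  minimizer of the exponent over to \<open>\<psi>\<close>; the endpoint 0 loses because
  \<open>\<psi> 0 = \<Delta>\<^sub>0\<close> and the minimal exponent is negative.\<close>

lemma restart_opt_minimal:
  assumes "\<theta> > 1 / 4" "c > 0" "\<Delta>\<^sub>0 > 0" "\<rho> > 0" "L > 0" "T > 0"
  defines "\<psi> \<equiv> restart_psi \<theta> c \<Delta>\<^sub>0 \<rho> L T" and "N \<equiv> restart_opt \<theta> c \<Delta>\<^sub>0 \<rho> L T"
  shows "N > 0" "\<psi> N < \<Delta>\<^sub>0" "x \<ge> 0 \<Longrightarrow> \<psi> N \<le> \<psi> x"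
proof -
  let ?C = "restart_C \<theta> c \<Delta>\<^sub>0 \<rho> L"
  let ?\<phi> = "\<lambda>x. (1 - exp (- (ln (4 * \<theta>) * x))) * ln (?C / T * x)"
  have C: "?C > 0" using assms by (intro restart_C_pos)
  obtain m where m: "m > 0" "?\<phi> m < 0" "\<And>x. x > 0 \<Longrightarrow> ?\<phi> m \<le> ?\<phi> x"
    using exp_log_product_has_min[of "ln (4 * \<theta>)" "?C / T"] assms(1) C \<open>T > 0\<close> by auto
  have \<psi>: "\<psi> x = \<Delta>\<^sub>0 * exp (?\<phi> x / (4 * \<theta> - 1))" if "x > 0" for x
    unfolding \<psi>_def using restart_psi_pos_eq_exp[OF _ that C \<open>T > 0\<close>] assms(1) by simp
  have "?\<phi> m / (4 * \<theta> - 1) < 0"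
    using m(2) assms(1) by (intro divide_neg_pos) auto
  then have m0: "\<psi> m < \<Delta>\<^sub>0"
    unfolding \<psi>[OF m(1)] using \<open>\<Delta>\<^sub>0 > 0\<close> by simp
  have min: "\<psi> m \<le> \<psi> x" if "x \<ge> 0" for x
  proof (cases "x = 0")
    case True
    then show ?thesis using m0 assms(1) by (simp add: \<psi>_def restart_psi_0)
  next
    case False
    then have "x > 0" using that by simp
    then have "?\<phi> m / (4 * \<theta> - 1) \<le> ?\<phi> x / (4 * \<theta> - 1)"
      using m(3) assms(1) by (intro divide_right_mono) auto
    then show ?thesis
      unfolding \<psi>[OF m(1)] \<psi>[OF \<open>x > 0\<close>] using \<open>\<Delta>\<^sub>0 > 0\<close> by simp
  qed
  have "is_arg_min \<psi> (\<lambda>x. x \<in> {0..}) m"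
    using m(1) min by (simp add: is_arg_min_linorder)
  then have "is_arg_min \<psi> (\<lambda>x. x \<in> {0..}) N"
    unfolding N_def restart_opt_def arg_min_on_def arg_min_def \<psi>_def by (rule someI)
  then have N: "N \<ge> 0" "\<And>x. x \<ge> 0 \<Longrightarrow> \<psi> N \<le> \<psi> x"
    by (auto simp: is_arg_min_linorder)
  have "\<psi> N \<le> \<psi> m" using N(2) m(1) by simp
  then show less: "\<psi> N < \<Delta>\<^sub>0" using m0 by simp
  then have "N \<noteq> 0" using assms(1) by (auto simp: \<psi>_def restart_psi_0)
  then show "N > 0" using N(1) by simp
  show "x \<ge> 0 \<Longrightarrow> \<psi> N \<le> \<psi> x" by (rule N(2))
qed

theorem theorem4p6:
  fixes \<theta> c \<Delta>\<^sub>0 \<rho> L T N :: real and \<psi> :: "real \<Rightarrow> real"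
  assumes "1 / 2 \<le> \<theta>" and "\<theta> \<le> 1"
    and "c > 0" and "\<Delta>\<^sub>0 > 0" and "\<rho> > 0" and "L > 0" and "T > 0"
    and "\<psi> = restart_psi \<theta> c \<Delta>\<^sub>0 \<rho> L T"
    and "N = restart_opt \<theta> c \<Delta>\<^sub>0 \<rho> L T"
  shows "(\<lambda>\<tau>. \<psi> (\<tau> * N) / \<psi> N
            - (1 + (N * ln (4 * \<theta>) * ((4 * \<theta>) powr (- N) + 1) + (4 * \<theta>) powr (- N) - 1)
                     / (2 * (4 * \<theta> - 1)) * (ln \<tau>)\<^sup>2))
           \<in> o[at 1 within {0<..}](\<lambda>\<tau>. (ln \<tau>)\<^sup>2)
         \<and> (\<forall>\<tau>>1. \<psi> (\<tau> * N) / \<psi> N < \<tau> powr (1 / (4 * \<theta> - 1)))"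
proof -
  define k where "k = restart_C \<theta> c \<Delta>\<^sub>0 \<rho> L / T"
  define p where "p = 4 * \<theta> - 1"
  define b where "b = ln (4 * \<theta>) * N"
  define l where "l = ln (k * N)"
  have C: "restart_C \<theta> c \<Delta>\<^sub>0 \<rho> L > 0" using assms by (intro restart_C_pos)
  have k: "k > 0" using C assms by (simp add: k_def)
  have p: "p > 0" using assms by (simp add: p_def)
  have \<theta>: "\<theta> > 1 / 4" using assms by simp
  note opt = restart_opt_minimal[OF \<theta> assms(3-7), folded assms(8,9)]
  have N: "N > 0" by (rule opt(1))
  have b: "b > 0" using N \<theta> by (simp add: b_def)
  have \<psi>: "\<psi> (exp s * N) = \<Delta>\<^sub>0 * exp ((1 - exp (- (b * exp s))) * (l + s) / p)" for s
  proof -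
    have "ln (k * (exp s * N)) = l + s"
      using k N by (simp add: l_def ln_mult)
    then show ?thesis
      using restart_psi_pos_eq_exp[of \<theta> "exp s * N", OF _ _ C \<open>T > 0\<close>] \<theta> N
      by (simp add: assms(8) b_def p_def mult_ac flip: k_def)
  qed
  have \<psi>N: "\<psi> N = \<Delta>\<^sub>0 * exp ((1 - exp (- b)) * l / p)" using \<psi>[of 0] by simp
  define G where "G s = ((1 - exp (- (b * exp s))) * (l + s) - (1 - exp (- b)) * l) / p" for s
  have ratio: "\<psi> (exp s * N) / \<psi> N = exp (G s)" for s
    unfolding \<psi> \<psi>N G_def diff_divide_distrib exp_diff using \<open>\<Delta>\<^sub>0 > 0\<close> by simp
  have G0: "G 0 = 0" by (simp add: G_def)

  have "(1 - exp (- b)) * l / p < 0"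
    using opt(2) \<open>\<Delta>\<^sub>0 > 0\<close> unfolding \<psi>N by simp
  then have l: "l < 0" using b p by (simp add: divide_less_0_iff mult_less_0_iff)

  define G' where "G' s = (b * exp s * exp (- (b * exp s)) * (l + s) + (1 - exp (- (b * exp s)))) / p"
    for s
  have dG: "(G has_real_derivative G' s) (at s)" for s
    unfolding G_def [abs_def] G'_def using p
    by (auto intro!: derivative_eq_intros simp: field_simps)
  have "G 0 \<le> G s" for s
  proof -
    have "\<psi> N \<le> \<psi> (exp s * N)" using N by (intro opt(3)) simp
    moreover have "\<psi> N > 0" using \<open>\<Delta>\<^sub>0 > 0\<close> by (simp add: \<psi>N)
    ultimately have "1 \<le> exp (G s)" by (simp flip: ratio)
    then show ?thesis by (simp add: G0)
  qed
  then have G'0: "G' 0 = 0"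
    \<comment> \<open>The minimum is over all real \<open>s\<close>, so any radius serves as
      neighbourhood; 1 is arbitrary.\<close>
    by (intro DERIV_local_min[OF dG, of 1]) auto
  then have foc: "b * exp (- b) * l = exp (- b) - 1"
    using p by (simp add: G'_def)

  define K where "K = (b * (exp (- b) + 1) + exp (- b) - 1) / p"
  have "((\<lambda>s. b * exp s * exp (- (b * exp s)) * (l + s) + (1 - exp (- (b * exp s))))
      has_real_derivative (b - b\<^sup>2) * exp (- b) * l + 2 * b * exp (- b)) (at 0)"
    by (auto intro!: derivative_eq_intros simp: algebra_simps power2_eq_square)
  \<comment> \<open>The first summand is \<open>(1 - b)\<close> times the left side of
    \<open>foc\<close>.\<close>
  moreover have "(b - b\<^sup>2) * exp (- b) * l + 2 * b * exp (- b) = b * (exp (- b) + 1) + exp (- b) - 1"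
    using foc by algebra
  ultimately have "(G' has_real_derivative K) (at 0)"
    unfolding G'_def [abs_def] K_def by (intro DERIV_cdivide) simp
  \<comment> \<open>The second derivative of \<open>exp (G s)\<close> is \<open>exp (G s)\<close>
    times the sum of \<open>(G' s)\<^sup>2\<close> and the derivative of \<open>G'\<close>; at 0
    this is just \<open>K\<close>.\<close>
  then have d2: "((\<lambda>s. exp (G s) * G' s) has_real_derivative K) (at 0)"
    using dG[of 0] by (auto intro!: derivative_eq_intros simp: G0 G'0)
  have d1: "((\<lambda>s. exp (G s)) has_real_derivative exp (G s) * G' s) (at s)" for s
    using dG[of s] by (auto intro!: derivative_eq_intros)
  have "(\<lambda>s. exp (G s) - (1 + K / 2 * s\<^sup>2)) \<in> o[at 0](\<lambda>s. s\<^sup>2)"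
    using taylor_peano_second_order[OF always_eventually[OF allI[OF d1]] d1 d2] by (simp add: G0 G'0)
  \<comment> \<open>The filter \<open>at 0\<close> is punctured, so \<open>ln \<tau>\<close> must
    also avoid 0 for the substitution \<open>s = ln \<tau>\<close>.\<close>
  moreover have "filterlim ln (at 0) (at 1 within {0<..} :: real filter)"
  proof (rule filterlim_atI)
    show "(ln \<longlongrightarrow> 0) (at 1 within {0<..} :: real filter)"
      by (auto intro!: tendsto_eq_intros)
    show "\<forall>\<^sub>F \<tau> in at 1 within {0<..}. ln \<tau> \<noteq> (0::real)"
      by (auto simp: eventually_at_filter)
  qed
  ultimately have "(\<lambda>\<tau>. exp (G (ln \<tau>)) - (1 + K / 2 * (ln \<tau>)\<^sup>2))
      \<in> o[at 1 within {0<..}](\<lambda>\<tau>. (ln \<tau>)\<^sup>2)"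
    by (rule landau_o.small.compose)
  moreover have "\<forall>\<^sub>F \<tau> in at 1 within {0<..}. exp (G (ln \<tau>)) - (1 + K / 2 * (ln \<tau>)\<^sup>2)
      = \<psi> (\<tau> * N) / \<psi> N - (1 + K / 2 * (ln \<tau>)\<^sup>2)"
    by (auto simp: eventually_at_filter simp flip: ratio)
  ultimately have "(\<lambda>\<tau>. \<psi> (\<tau> * N) / \<psi> N - (1 + K / 2 * (ln \<tau>)\<^sup>2))
      \<in> o[at 1 within {0<..}](\<lambda>\<tau>. (ln \<tau>)\<^sup>2)"
    by (rule landau_o.small.in_cong[THEN iffD1, rotated])
  moreover have "(4 * \<theta>) powr (- N) = exp (- b)"
    using \<theta> by (simp add: powr_def b_def mult_ac)
  then have "K / 2 = (N * ln (4 * \<theta>) * ((4 * \<theta>) powr (- N) + 1) + (4 * \<theta>) powr (- N) - 1)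
      / (2 * (4 * \<theta> - 1))"
    unfolding K_def p_def by (simp add: b_def mult.commute)
  ultimately have *: "(\<lambda>\<tau>. \<psi> (\<tau> * N) / \<psi> N
      - (1 + (N * ln (4 * \<theta>) * ((4 * \<theta>) powr (- N) + 1) + (4 * \<theta>) powr (- N) - 1)
               / (2 * (4 * \<theta> - 1)) * (ln \<tau>)\<^sup>2))
      \<in> o[at 1 within {0<..}](\<lambda>\<tau>. (ln \<tau>)\<^sup>2)"
    by (simp only:)

  have "\<psi> (\<tau> * N) / \<psi> N < \<tau> powr (1 / (4 * \<theta> - 1))" if "\<tau> > 1" for \<tau>
  proof -
    have "exp (- (b * \<tau>)) \<le> exp (- b)" using b that by simp
    then have "(exp (- b) - exp (- (b * \<tau>))) * l \<le> 0"
      using l by (intro mult_nonneg_nonpos) auto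
    moreover have "(1 - exp (- (b * \<tau>))) * ln \<tau> < ln \<tau>"
      using that by simp
    \<comment> \<open>The left side regroups as the sum of the two products just bounded.\<close>
    ultimately have "(1 - exp (- (b * \<tau>))) * (l + ln \<tau>) - (1 - exp (- b)) * l < ln \<tau>"
      by (simp add: algebra_simps)
    then have "G (ln \<tau>) < ln \<tau> / p"
      using p that by (simp add: G_def divide_strict_right_mono)
    then show ?thesis
      using ratio[of "ln \<tau>"] that by (simp add: powr_def p_def)
  qed
  with * show ?thesis by blast
qed

end
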